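(* Let $\alpha\in\mathbb{C}$ and let $s_1,s_2$ be the two roots (counted with multiplicity) of $z^2+(3-2\alpha)z+1=0$, which are fixed points of the rational map $O_p$ with parameter $\alpha$. The fixed points $z=s_i$, $i=1,2$, satisfy the following statements: (i) If $|\alpha-3|<\frac12$, then $s_1$ and $s_2$ are two different attractive fixed points of $O_p$. In particular, for $\alpha=3$, $s_1$ and $s_2$ are superattractors. (ii) If $|\alpha-3|=\frac12$, then $s_1$ and $s_2$ are parabolic points of $O_p$. In particular, for $\alpha=\frac52$, $s_1=s_2=1$. (iii) If $|\alpha-3|>\frac12$, then $s_1$ and $s_2$ are repulsive fixed points of $O_p$.
   Context: For a parameter $\alpha\in\mathbb{C}$, let $O_p:\hat{\mathbb{C}}\to\hat{\mathbb{C}}$ be the rational map of the Riemann sphere $$O_p(z)=z^3\,\frac{z-2(\alpha-1)}{1-2(\alpha-1)z},$$ understood as a rational function (common factors of numerator and denominator cancelled). It is the operator conjugate to the Chebyshev-Halley iteration with parameter $\alpha$ applied to quadratic polynomials. Explicitly, $s_1,s_2$ are $\frac{-3+2\alpha\pm\sqrt{5-12\alpha+4\alpha^2}}{2}$. A fixed point $z_0\in\mathbb{C}$ of a rational map $R$ (i.e. $R(z_0)=z_0$) is called an attractor (attractive) if $|R'(z_0)|<1$, a superattractor if $|R'(z_0)|=0$, a repulsor (repulsive) if $|R'(z_0)|>1$, and parabolic if $|R'(z_0)|=1$. *)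

theory Defs
  imports
    "HOL-Analysis.Analysis"
    "HOL-Computational_Algebra.Polynomial_Factorial"
    "HOL-Computational_Algebra.Field_as_Ring"
begin

text \<open>
  Rational functions over the complex numbers are elements of the fraction field
  \<^typ>\<open>complex poly fract\<close>. The Riemann sphere is \<^typ>\<open>complex option\<close>, with
  \<^term>\<open>None\<close> as the point at infinity.
\<close>

type_synonym rational_function = "complex poly fract"

type_synonym riemann_sphere = "complex option"

text \<open>
  \<^const>\<open>quot_of_fract\<close> yields the representation in lowest terms, so common factors of the
  numerator and the denominator are cancelled. At a pole, \<open>rat_eval\<close> has the junk value \<open>0\<close>.
\<close>

definition rat_eval :: "rational_function \<Rightarrow> complex \<Rightarrow> complex" where
  "rat_eval R z = (case quot_of_fract R of (p, q) \<Rightarrow> poly p z / poly q z)"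

text \<open>
  At infinity, the value is the limit of \<open>p(z) / q(z)\<close>; note that
  \<open>coeff p (degree q) = 0\<close> if \<open>degree p < degree q\<close>.
\<close>

definition rat_map :: "rational_function \<Rightarrow> riemann_sphere \<Rightarrow> riemann_sphere" where
  "rat_map R x = (case quot_of_fract R of (p, q) \<Rightarrow>
     (case x of
        Some z \<Rightarrow> if poly q z = 0 then None else Some (rat_eval R z)
      | None \<Rightarrow> if degree p > degree q then None
                else Some (coeff p (degree q) / lead_coeff q)))"

definition fixed_point :: "rational_function \<Rightarrow> complex \<Rightarrow> bool" where
  "fixed_point R z \<longleftrightarrow> rat_map R (Some z) = Some z"

definition attractor :: "rational_function \<Rightarrow> complex \<Rightarrow> bool" where
  "attractor R z \<longleftrightarrow> fixed_point R z \<and> norm (deriv (rat_eval R) z) < 1"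

definition superattractor :: "rational_function \<Rightarrow> complex \<Rightarrow> bool" where
  "superattractor R z \<longleftrightarrow> fixed_point R z \<and> norm (deriv (rat_eval R) z) = 0"

definition repulsor :: "rational_function \<Rightarrow> complex \<Rightarrow> bool" where
  "repulsor R z \<longleftrightarrow> fixed_point R z \<and> norm (deriv (rat_eval R) z) > 1"

definition parabolic :: "rational_function \<Rightarrow> complex \<Rightarrow> bool" where
  "parabolic R z \<longleftrightarrow> fixed_point R z \<and> norm (deriv (rat_eval R) z) = 1"

definition O_p :: "complex \<Rightarrow> rational_function" where
  "O_p \<alpha> = Fract ([:0, 1:] ^ 3 * [:- (2 * (\<alpha> - 1)), 1:]) [:1, - (2 * (\<alpha> - 1)):]"

end

theory Submission
  imports Defs "HOL-Computational_Algebra.Fundamental_Theorem_Algebra"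
begin

text \<open>
  After clearing denominators, \<open>O\<^sub>p(s) - s\<close> and \<open>O\<^sub>p'(s) - (6 - 2\<alpha>)\<close> are multiples of
  \<open>s\<^sup>2 + (3 - 2\<alpha>)s + 1\<close>, so both \<open>s\<^sub>i\<close> are fixed with multiplier \<open>6 - 2\<alpha>\<close> unless the
  denominator vanishes there. That happens only for \<open>s = -1\<close>, \<open>\<alpha> = 1/2\<close>; then \<open>O\<^sub>p\<close> cancels
  to \<open>z\<^sup>3\<close>, whose multiplier \<open>3\<close> at \<open>-1\<close> differs from \<open>6 - 2\<alpha> = 5\<close> but is still repelling.
\<close>

text \<open>Values may be computed from an uncancelled representation wherever its denominator is
  nonzero. Cross-multiplying, a zero of \<open>q'\<close> at \<open>z\<close> would force a zero of
  \<open>p'\<close> there, contradicting coprimality.\<close>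

lemma quot_of_fract_Fract_poly:
  fixes p q p' q' :: "complex poly"
  assumes quot: "quot_of_fract (Fract p q) = (p', q')" and q: "poly q z \<noteq> 0"
  shows "poly q' z \<noteq> 0" and "poly p' z / poly q' z = poly p z / poly q z"
proof -
  have q0: "q \<noteq> 0" using q by auto
  have q'0: "q' \<noteq> 0" using snd_quot_of_fract_nonzero[of "Fract p q"] quot by simp
  have "Fract p' q' = Fract p q" using Fract_quot_of_fract[of "Fract p q"] quot by simp
  hence "p' * q = p * q'" using q0 q'0 by (simp add: eq_fract)
  hence cross: "poly p' z * poly q z = poly p z * poly q' z" by (metis poly_mult)
  have "coprime p' q'" using coprime_quot_of_fract[of "Fract p q"] quot by simp
  hence "poly p' z \<noteq> 0 \<or> poly q' z \<noteq> 0" by (rule coprime_poly_0)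
  with cross q show nz: "poly q' z \<noteq> 0" by auto
  show "poly p' z / poly q' z = poly p z / poly q z"
    using cross q nz by (simp add: frac_eq_eq)
qed

lemma rat_eval_Fract:
  assumes "poly q z \<noteq> 0"
  shows "rat_eval (Fract p q) z = poly p z / poly q z"
  using quot_of_fract_Fract_poly[OF _ assms, of p]
  by (auto simp: rat_eval_def split: prod.split)

lemma fixed_point_Fract:
  assumes "poly q z \<noteq> 0"
  shows "fixed_point (Fract p q) z \<longleftrightarrow> poly p z = z * poly q z"
  using quot_of_fract_Fract_poly(1)[OF _ assms, of p] rat_eval_Fract[OF assms, of p] assms
  by (auto simp: fixed_point_def rat_map_def field_simps split: prod.split)

lemma deriv_rat_eval_Fract:
  assumes "poly q z \<noteq> 0"
  shows "deriv (rat_eval (Fract p q)) z =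
    (poly (pderiv p) z * poly q z - poly p z * poly (pderiv q) z) / (poly q z)\<^sup>2"
proof (rule DERIV_imp_deriv)
  \<comment> \<open>Nonvanishing of \<open>q\<close> is an open condition, so
    \<open>rat_eval\<close> agrees with the quotient on a whole neighbourhood and the quotient rule
    applies.\<close>
  have "\<forall>\<^sub>F w in nhds z. poly q w \<noteq> 0"
    using assms by (intro eventually_nhds_in_open[of "{w. poly q w \<noteq> 0}", simplified])
      (auto intro!: open_Collect_neq continuous_intros)
  hence "\<forall>\<^sub>F w in nhds z. rat_eval (Fract p q) w = poly p w / poly q w"
    by eventually_elim (rule rat_eval_Fract)
  moreover have "((\<lambda>w. poly p w / poly q w) has_field_derivative
      (poly (pderiv p) z * poly q z - poly p z * poly (pderiv q) z) / (poly q z)\<^sup>2) (at z)"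
    using assms by (auto intro!: derivative_eq_intros simp: power2_eq_square)
  ultimately show "(rat_eval (Fract p q) has_field_derivative
      (poly (pderiv p) z * poly q z - poly p z * poly (pderiv q) z) / (poly q z)\<^sup>2) (at z)"
    by (simp add: DERIV_cong_ev[OF refl _ refl])
qed

lemma O_p_fixed_multiplier:
  assumes s: "s\<^sup>2 + (3 - 2 * \<alpha>) * s + 1 = 0" and "s \<noteq> - 1"
  shows "fixed_point (O_p \<alpha>) s" and "deriv (rat_eval (O_p \<alpha>)) s = 6 - 2 * \<alpha>"
proof -
  define p where "p = [:0, 1:] ^ 3 * [:- (2 * (\<alpha> - 1)), 1:]"
  define q where "q = [:1, - (2 * (\<alpha> - 1)):]"
  have R: "O_p \<alpha> = Fract p q" by (simp add: O_p_def p_def q_def)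
  have p: "p = [:0, 0, 0, - (2 * (\<alpha> - 1)), 1:]"
    by (simp add: p_def power3_eq_cube)
  have "s \<noteq> 0" using s by auto
  \<comment> \<open>Modulo the quadratic the denominator factors, which leaves \<open>- 1\<close> as
    the only root where it can vanish.\<close>
  have "poly q s = - s * (s + 1) + (s\<^sup>2 + (3 - 2 * \<alpha>) * s + 1)"
    by (simp add: q_def algebra_simps power2_eq_square)
  hence "poly q s = - s * (s + 1)" by (simp only: s add_0_right)
  hence qs: "poly q s \<noteq> 0" using \<open>s \<noteq> 0\<close> \<open>s \<noteq> - 1\<close> by (simp add: add_eq_0_iff2)
  have "poly p s = s * poly q s + s * (s - 1) * (s\<^sup>2 + (3 - 2 * \<alpha>) * s + 1)"
    by (simp add: p q_def algebra_simps power2_eq_square)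
  hence ps: "poly p s = s * poly q s" by (simp only: s mult_zero_right add_0_right)
  with qs show "fixed_point (O_p \<alpha>) s" by (simp add: R fixed_point_Fract)
  \<comment> \<open>Since \<open>p(s) = s q(s)\<close>, the numerator of the quotient rule is
    \<open>q(s)\<close> times this left-hand side. Dividing it by the quadratic gives the quotient
    \<open>4 * s + 2 * \<alpha> - 6\<close> and the remainder
    \<open>(6 - 2 * \<alpha>) * q(s)\<close>.\<close>
  have "poly (pderiv p) s - s * poly (pderiv q) s =
      (6 - 2 * \<alpha>) * poly q s + (4 * s + 2 * \<alpha> - 6) * (s\<^sup>2 + (3 - 2 * \<alpha>) * s + 1)"
    by (simp add: p q_def pderiv_pCons algebra_simps power2_eq_square)
  hence "poly (pderiv p) s - s * poly (pderiv q) s = (6 - 2 * \<alpha>) * poly q s"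
    by (simp only: s mult_zero_right add_0_right)
  hence "poly (pderiv p) s * poly q s - poly p s * poly (pderiv q) s = (6 - 2 * \<alpha>) * (poly q s)\<^sup>2"
    unfolding ps power2_eq_square by (metis left_diff_distrib mult.assoc mult.commute)
  thus "deriv (rat_eval (O_p \<alpha>)) s = 6 - 2 * \<alpha>"
    using qs by (simp add: R deriv_rat_eval_Fract)
qed

lemma O_p_half: "O_p (1 / 2) = Fract ([:0, 1:] ^ 3) 1"
  by (simp add: O_p_def eq_fract pCons_one)

lemma O_p_half_multiplier:
  shows "fixed_point (O_p (1 / 2)) (- 1)" and "deriv (rat_eval (O_p (1 / 2))) (- 1) = 3"
  by (simp_all add: O_p_half fixed_point_Fract deriv_rat_eval_Fract pderiv_power pderiv_pCons)

text \<open>For \<open>s \<noteq> - 1\<close> the multiplier has norm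
  \<open>2 * norm (\<alpha> - 3)\<close>, which turns the threshold 1 into 1/2. At
  \<open>s = - 1\<close> the quadratic equals \<open>2 * \<alpha> - 1\<close>, so
  \<open>\<alpha> = 1 / 2\<close>, at distance 5/2 from 3: only the repelling case arises.\<close>

lemma O_p_root_classification:
  assumes s: "s\<^sup>2 + (3 - 2 * \<alpha>) * s + 1 = 0"
  shows "fixed_point (O_p \<alpha>) s \<and>
    (norm (\<alpha> - 3) < 1 / 2 \<longrightarrow> attractor (O_p \<alpha>) s) \<and>
    (\<alpha> = 3 \<longrightarrow> superattractor (O_p \<alpha>) s) \<and>
    (norm (\<alpha> - 3) = 1 / 2 \<longrightarrow> parabolic (O_p \<alpha>) s) \<and>
    (norm (\<alpha> - 3) > 1 / 2 \<longrightarrow> repulsor (O_p \<alpha>) s)"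
proof -
  consider "s \<noteq> - 1" | "s = - 1" "\<alpha> = 1 / 2"
    using s by (cases "s = - 1") (auto simp: field_simps)
  thus ?thesis
  proof cases
    case 1
    have "6 - 2 * \<alpha> = - 2 * (\<alpha> - 3)" by simp
    hence "norm (6 - 2 * \<alpha>) = 2 * norm (\<alpha> - 3)" by (simp only: norm_mult) simp
    with O_p_fixed_multiplier[OF s 1] show ?thesis
      by (auto simp: attractor_def superattractor_def parabolic_def repulsor_def)
  next
    case 2
    have "norm (\<alpha> - 3) = 5 / 2" by (simp add: 2 norm_divide)
    with O_p_half_multiplier show ?thesis
      unfolding 2 by (auto simp: repulsor_def)
  qed
qed

theorem proposition2:
  fixes \<alpha> s\<^sub>1 s\<^sub>2 :: complex
  assumes "proots [:1, 3 - 2 * \<alpha>, 1:] = {#s\<^sub>1, s\<^sub>2#}"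
  shows "(fixed_point (O_p \<alpha>) s\<^sub>1 \<and> fixed_point (O_p \<alpha>) s\<^sub>2) \<and>
    (norm (\<alpha> - 3) < 1 / 2 \<longrightarrow>
       s\<^sub>1 \<noteq> s\<^sub>2 \<and> attractor (O_p \<alpha>) s\<^sub>1 \<and> attractor (O_p \<alpha>) s\<^sub>2) \<and>
    (\<alpha> = 3 \<longrightarrow> superattractor (O_p \<alpha>) s\<^sub>1 \<and> superattractor (O_p \<alpha>) s\<^sub>2) \<and>
    (norm (\<alpha> - 3) = 1 / 2 \<longrightarrow> parabolic (O_p \<alpha>) s\<^sub>1 \<and> parabolic (O_p \<alpha>) s\<^sub>2) \<and>
    (\<alpha> = 5 / 2 \<longrightarrow> s\<^sub>1 = 1 \<and> s\<^sub>2 = 1) \<and>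
    (norm (\<alpha> - 3) > 1 / 2 \<longrightarrow> repulsor (O_p \<alpha>) s\<^sub>1 \<and> repulsor (O_p \<alpha>) s\<^sub>2)"
proof -
  \<comment> \<open>Counting roots with multiplicity gives the full factorisation, so that
    \<open>s\<^sub>1 = s\<^sub>2\<close> really means a double root.\<close>
  have "[:1, 3 - 2 * \<alpha>, 1:] = [:- s\<^sub>1, 1:] * [:- s\<^sub>2, 1:]"
    using complex_poly_decompose_multiset[of "[:1, 3 - 2 * \<alpha>, 1:]"] by (simp add: assms)
  hence vieta: "s\<^sub>1 * s\<^sub>2 = 1" "s\<^sub>1 + s\<^sub>2 = 2 * \<alpha> - 3"
    by (auto simp: algebra_simps)
  have roots: "s\<^sub>1\<^sup>2 + (3 - 2 * \<alpha>) * s\<^sub>1 + 1 = 0" "s\<^sub>2\<^sup>2 + (3 - 2 * \<alpha>) * s\<^sub>2 + 1 = 0"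
    using vieta by (simp_all add: algebra_simps power2_eq_square) algebra+
  have distinct: "s\<^sub>1 \<noteq> s\<^sub>2" if "norm (\<alpha> - 3) < 1 / 2"
  proof
    assume "s\<^sub>1 = s\<^sub>2"
    \<comment> \<open>A double root is 1 or -1, so \<alpha> is 5/2 or 1/2; neither lies in the open
      disc of radius 1/2 about 3.\<close>
    hence "s\<^sub>1\<^sup>2 = 1" and \<alpha>: "\<alpha> = (2 * s\<^sub>1 + 3) / 2"
      using vieta by (simp_all add: power2_eq_square)
    hence "s\<^sub>1 = 1 \<or> s\<^sub>1 = - 1" by (simp add: power2_eq_1_iff)
    hence "\<alpha> - 3 = - 1 / 2 \<or> \<alpha> - 3 = - 5 / 2" by (auto simp: \<alpha>)
    with that show False by (auto simp: norm_divide)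
  qed
  have one: "s\<^sub>1 = 1 \<and> s\<^sub>2 = 1" if "\<alpha> = 5 / 2"
  proof -
    have "(s\<^sub>1 - 1)\<^sup>2 = 0" "(s\<^sub>2 - 1)\<^sup>2 = 0"
      using roots unfolding that by (simp_all add: power2_eq_square algebra_simps)
    thus ?thesis by simp
  qed
  show ?thesis
    using distinct one O_p_root_classification[OF roots(1)] O_p_root_classification[OF roots(2)]
    by blast
qed

end
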